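(* Let $n\ge 1$ and $d\ge 1$ be integers. Let $\Omega\subset\mathbb R^d$ be a bounded $C^{1,1}$ domain, let $f\in L^2(\Omega)$, and let $A(x,y_1,\dots,y_n)$ be an elliptic, periodic (in each $y_k$) and Lipschitz continuous coefficient. Consider the $(n+1)$-scale canonical elliptic model and the corresponding homogenization model defined in the context, with scales $\varepsilon_k=\varepsilon_1^k$, $k=1,\dots,n$, and a prescribed precision threshold $\delta=O(\varepsilon_1)$. Let $\mathcal C_{can},\mathcal Q_{can},\mathcal C_{hom},\mathcal Q_{hom}$ be the classical and quantum costs of the canonical and homogenization models defined in the context, and compare them by their orders in $\varepsilon_1$ (as defined in the context), for fixed $n,d$ and $\varepsilon_1\to0$. Then: 1. Quantum advantage in $\varepsilon_1$: if $(n+1)d>3$, then the order in $\varepsilon_1$ of $\mathcal Q_{hom}$ is strictly smaller than that of $\mathcal C_{hom}$; if $(n+1)(d-1)>2$, then the order in $\varepsilon_1$ of $\mathcal Q_{can}$ is strictly smaller than that of $\mathcal C_{can}$. 2. The order in $\varepsilon_1$ of $\mathcal C_{hom}$ is strictly smaller than that of $\mathcal C_{can}$, and the order in $\varepsilon_1$ of $\mathcal Q_{hom}$ is strictly smaller than that of $\mathcal Q_{can}$. 3. If $(n+1)d>3$, then among the four costs $\mathcal C_{can},\mathcal Q_{can},\mathcal C_{hom},\mathcal Q_{hom}$, the quantum cost $\mathcal Q_{hom}$ of the homogenization model has the smallest order in $\varepsilon_1$ (so the quantum algorithm for the homogenization model is the most recommended one).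
   Context: **Canonical model.** Let $Y_k=Y=[0,1]^d$ be the unit cell of the variable $y_k$. Find $u_\varepsilon$ with $-\mathrm{div}(A_\varepsilon\nabla u_\varepsilon)=f$ in $\Omega$ and $u_\varepsilon=0$ on $\partial\Omega$, where $A_\varepsilon(x)=A(x,\frac{x}{\varepsilon_1},\dots,\frac{x}{\varepsilon_n})$, $A$ is periodic in each $y_k$, and $\alpha|\xi|^2\le A\xi\cdot\xi\le\beta|\xi|^2$ for all $\xi\in\mathbb R^d$, with constants $\beta\ge\alpha>0$. **Homogenization model.** Find $u_0(x)$ and $u_k(x,y_1,\dots,y_k)$, $k=1,\dots,n$ (periodic in the $y$ variables), such that, with $G=\nabla_xu_0+\sum_{j=1}^n\nabla_{y_j}u_j$: $-\mathrm{div}_{y_n}(AG)=0$; $-\mathrm{div}_{y_k}\int_{Y_{k+1}}\cdots\int_{Y_n}AG\,dy_{k+1}\cdots dy_n=0$ for $1\le k\le n-1$; and $-\mathrm{div}_x\int_{Y_1}\cdots\int_{Y_n}AG\,dy_1\cdots dy_n=f$. **Methods.** Each model is discretized by tensor-product piecewise linear finite elements of mesh size $h$ ($N\sim 1/h$ nodes per coordinate direction), giving a linear system $\mathbf A\mathbf u=\mathbf F$. The classical method is conjugate gradients. The quantum method approximates $\mathbf u$ by the solution at a large time $t$ of $\dot{\mathbf u}=-\mathbf A\mathbf u+\mathbf F$, simulated by Schrödingerisation (conversion into a Hamiltonian system by adding one variable $p$ discretized with step $\Delta p$). The costs are the following complexity estimates. They do not include encoding of initial data or quantum measurement. **Classical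 cost.** $\mathcal C=s\cdot(\text{number of unknowns})\cdot\sqrt{\kappa}\,\log(1/\delta)$, where $s$ is the sparsity (number of nonzero entries per row) and $\kappa$ the condition number, taken as follows. - Canonical: $s=3^d$, $\kappa=3^d d\,h^{-2}$ (up to constants), $N^d$ unknowns, and $h\sim\sqrt{\delta\varepsilon_n}$ (discretization error $h^2/\varepsilon_n\lesssim\delta$). - Homogenization: $s=\sum_{k=1}^{n+1}3^{kd}$, $\kappa=3^{(n+1)d}d\,h^{-2}$ (up to constants), $\sum_{k=1}^{n+1}N^{kd}$ unknowns, and $h\sim\sqrt\delta$ (discretization error $h^2\lesssim\delta$). **Quantum cost.** $\mathcal Q=\tau\, m\cdot\mathrm{polylog}$, with $\mathrm{polylog}=\log^{2.5}(\tau/\delta)\,\frac{\log(\tau/\delta)}{\log\log(\tau/\delta)}$. Here $\tau=s\|\mathbf H_{total}\|_{\max}t$ is sparsity times maximal entry of the Hamiltonian times evolution time, $m$ is the number of qubits, $t\sim\log(1/\delta)/\lambda_{\min}(\mathbf A)$ and $\Delta p\sim\delta$. These are taken as follows. - Canonical: $\tau\sim 3^{2d}d\,h^{-2}\log(\delta^{-1})/\Delta p$, $m\sim d\log N+\log(1/\Delta p)$, $h\sim\sqrt{\delta\varepsilon_n}$. - Homogenization: $\tau\sim3^{2(n+1)d}d\,h^{-2}\log(\delta^{-1})/\Delta p$, $m\sim nd\log N+\log(1/\Delta p)$, $h\sim\sqrt\delta$. In all costs $\delta$ is taken proportional to $\varepsilon_1$. **Order in $\varepsilon_1$.** A cost has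 order $q$ in $\varepsilon_1$ if, for fixed $n,d$, it equals $\varepsilon_1^{-q}$ as $\varepsilon_1\to0$, up to factors independent of $\varepsilon_1$ and factors polylogarithmic in $1/\varepsilon_1$. *)

theory Defs
  imports "HOL-Analysis.Analysis" "HOL-Real_Asymp.Real_Asymp"
begin

section \<open>Problem data\<close>

text \<open>
  The dimension is \<open>d = CARD('d)\<close>.  Near each boundary point the domain is the region above the graph
  of a function \<open>\<gamma>\<close> over the hyperplane orthogonal to a unit vector \<open>\<nu>\<close>; such a function is the same
  as a function on the whole space which is invariant under translations along \<open>\<nu>\<close>.
\<close>

definition C11_domain :: "(real ^ 'd) set \<Rightarrow> bool" where
  "C11_domain \<Omega> \<longleftrightarrow> open \<Omega> \<and> connected \<Omega> \<and> \<Omega> \<noteq> {} \<and>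
     (\<forall>x0 \<in> frontier \<Omega>. \<exists>r > 0. \<exists>\<nu> \<gamma> D\<gamma> L. norm \<nu> = 1 \<and>
        (\<forall>x. GDERIV \<gamma> x :> D\<gamma> x) \<and> L-lipschitz_on UNIV D\<gamma> \<and>
        (\<forall>x t. \<gamma> (x + t *\<^sub>R \<nu>) = \<gamma> x) \<and>
        \<Omega> \<inter> ball x0 r = {x \<in> ball x0 r. \<gamma> x < x \<bullet> \<nu>})"

definition L2 :: "'a measure \<Rightarrow> ('a \<Rightarrow> 'b :: euclidean_space) set" where
  "L2 M = {f \<in> borel_measurable M. integrable M (\<lambda>x. (norm (f x))\<^sup>2)}"

text \<open>
  A function of \<open>x, y\<^sub>1, \<dots>, y\<^sub>k\<close> is a function of \<open>x\<close> and of a sequence \<open>y\<close>, of which only the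
  entries with indices in \<open>{1..k}\<close> are relevant.
\<close>

definition periodic_upto :: "nat \<Rightarrow> ((nat \<Rightarrow> real ^ 'd) \<Rightarrow> 'b) \<Rightarrow> bool" where
  "periodic_upto k v \<longleftrightarrow> (\<forall>y. \<forall>j \<in> {1..k}. \<forall>i. v (y(j := y j + axis i 1)) = v y)"

definition depends_upto :: "nat \<Rightarrow> ((nat \<Rightarrow> real ^ 'd) \<Rightarrow> 'b) \<Rightarrow> bool" where
  "depends_upto k v \<longleftrightarrow> (\<forall>y y'. (\<forall>j \<in> {1..k}. y j = y' j) \<longrightarrow> v y = v y')"

type_synonym 'd coefficient = "real ^ 'd \<Rightarrow> (nat \<Rightarrow> real ^ 'd) \<Rightarrow> real ^ 'd ^ 'd"

definition elliptic :: "(real ^ 'd) set \<Rightarrow> 'd coefficient \<Rightarrow> bool" where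
  "elliptic \<Omega> A \<longleftrightarrow> (\<exists>\<alpha> \<beta>. 0 < \<alpha> \<and> \<alpha> \<le> \<beta> \<and>
     (\<forall>x \<in> \<Omega>. \<forall>y \<xi>. \<alpha> * (norm \<xi>)\<^sup>2 \<le> (A x y *v \<xi>) \<bullet> \<xi> \<and> (A x y *v \<xi>) \<bullet> \<xi> \<le> \<beta> * (norm \<xi>)\<^sup>2))"

definition lipschitz_coefficient :: "(real ^ 'd) set \<Rightarrow> nat \<Rightarrow> 'd coefficient \<Rightarrow> bool" where
  "lipschitz_coefficient \<Omega> n A \<longleftrightarrow> (\<exists>L. \<forall>x \<in> \<Omega>. \<forall>x' \<in> \<Omega>. \<forall>y y'.
     norm (A x y - A x' y') \<le> L * (dist x x' + (\<Sum>k = 1..n. dist (y k) (y' k))))"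

definition multiscale_data ::
    "nat \<Rightarrow> (real ^ 'd) set \<Rightarrow> (real ^ 'd \<Rightarrow> real) \<Rightarrow> 'd coefficient \<Rightarrow> bool" where
  "multiscale_data n \<Omega> f A \<longleftrightarrow> bounded \<Omega> \<and> C11_domain \<Omega> \<and> f \<in> L2 (lebesgue_on \<Omega>) \<and>
     (\<forall>x \<in> \<Omega>. depends_upto n (A x) \<and> periodic_upto n (A x)) \<and>
     elliptic \<Omega> A \<and> lipschitz_coefficient \<Omega> n A"


section \<open>The two elliptic models, in weak form\<close>

definition test_function ::
    "(real ^ 'd) set \<Rightarrow> (real ^ 'd \<Rightarrow> real) \<Rightarrow> (real ^ 'd \<Rightarrow> real ^ 'd) \<Rightarrow> bool" where
  "test_function \<Omega> \<phi> D\<phi> \<longleftrightarrow> (\<forall>x. GDERIV \<phi> x :> D\<phi> x) \<and> continuous_on UNIV D\<phi> \<and>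
     (\<exists>K. compact K \<and> K \<subseteq> \<Omega> \<and> (\<forall>x. x \<notin> K \<longrightarrow> \<phi> x = 0))"

text \<open>
  \<open>H10 \<Omega> u g\<close>: the function \<open>u\<close> belongs to \<open>H\<^sup>1\<^sub>0(\<Omega>)\<close>, the closure of the test functions in \<open>H\<^sup>1(\<Omega>)\<close>,
  and \<open>g\<close> is its weak gradient.
\<close>

definition H10 ::
    "(real ^ 'd) set \<Rightarrow> (real ^ 'd \<Rightarrow> real) \<Rightarrow> (real ^ 'd \<Rightarrow> real ^ 'd) \<Rightarrow> bool" where
  "H10 \<Omega> u g \<longleftrightarrow> u \<in> L2 (lebesgue_on \<Omega>) \<and> g \<in> L2 (lebesgue_on \<Omega>) \<and>
     (\<exists>\<phi> D\<phi>. (\<forall>i. test_function \<Omega> (\<phi> i) (D\<phi> i)) \<and>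
        (\<lambda>i. LINT x|lebesgue_on \<Omega>. (u x - \<phi> i x)\<^sup>2) \<longlonglongrightarrow> 0 \<and>
        (\<lambda>i. LINT x|lebesgue_on \<Omega>. (norm (g x - D\<phi> i x))\<^sup>2) \<longlonglongrightarrow> 0)"

definition oscillating :: "'d coefficient \<Rightarrow> (nat \<Rightarrow> real) \<Rightarrow> real ^ 'd \<Rightarrow> real ^ 'd ^ 'd" where
  "oscillating A \<epsilon> x = A x (\<lambda>k. x /\<^sub>R \<epsilon> k)"

text \<open>Weak form of \<open>-div (A\<^sub>\<epsilon> \<nabla>u) = f\<close> in \<open>\<Omega>\<close> with \<open>u = 0\<close> on the boundary, with scales \<open>\<epsilon> 1, \<dots>, \<epsilon> n\<close>.\<close>

definition canonical_model ::
    "(real ^ 'd) set \<Rightarrow> (real ^ 'd \<Rightarrow> real) \<Rightarrow> 'd coefficient \<Rightarrow> (nat \<Rightarrow> real) \<Rightarrow>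
     (real ^ 'd \<Rightarrow> real) \<Rightarrow> bool" where
  "canonical_model \<Omega> f A \<epsilon> u \<longleftrightarrow> (\<exists>g. H10 \<Omega> u g \<and>
     (\<forall>\<phi> D\<phi>. test_function \<Omega> \<phi> D\<phi> \<longrightarrow>
        (LINT x|lebesgue_on \<Omega>. (oscillating A \<epsilon> x *v g x) \<bullet> D\<phi> x) =
        (LINT x|lebesgue_on \<Omega>. f x * \<phi> x)))"

definition unit_cell :: "(real ^ 'd) set" where
  "unit_cell = cbox 0 1"

definition multiscale_measure ::
    "nat \<Rightarrow> (real ^ 'd) set \<Rightarrow> ((real ^ 'd) \<times> (nat \<Rightarrow> real ^ 'd)) measure" where
  "multiscale_measure n \<Omega> = lebesgue_on \<Omega> \<Otimes>\<^sub>M (\<Pi>\<^sub>M k \<in> {1..n}. lebesgue_on unit_cell)"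

text \<open>Functions of \<open>x, y\<^sub>1, \<dots>, y\<^sub>k\<close>, periodic in the \<open>y\<close> variables, with their \<open>y\<^sub>k\<close>-gradient.\<close>

definition cell_test_function ::
    "(real ^ 'd) set \<Rightarrow> nat \<Rightarrow> (real ^ 'd \<Rightarrow> (nat \<Rightarrow> real ^ 'd) \<Rightarrow> real) \<Rightarrow>
     (real ^ 'd \<Rightarrow> (nat \<Rightarrow> real ^ 'd) \<Rightarrow> real ^ 'd) \<Rightarrow> bool" where
  "cell_test_function \<Omega> k \<psi> D\<psi> \<longleftrightarrow>
     (\<forall>x. depends_upto k (\<psi> x) \<and> periodic_upto k (\<psi> x)) \<and>
     (\<forall>x y. GDERIV (\<lambda>\<eta>. \<psi> x (y(k := \<eta>))) (y k) :> D\<psi> x y) \<and>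
     continuous_on UNIV (\<lambda>(x, y). \<psi> x y) \<and> continuous_on UNIV (\<lambda>(x, y). D\<psi> x y) \<and>
     (\<exists>K. compact K \<and> K \<subseteq> \<Omega> \<and> (\<forall>x y. x \<notin> K \<longrightarrow> \<psi> x y = 0))"

text \<open>
  The space \<open>L\<^sup>2(\<Omega> \<times> Y\<^sub>1 \<times> \<dots> \<times> Y\<^sub>k\<^sub>-\<^sub>1; H\<^sup>1\<^sub>p\<^sub>e\<^sub>r(Y\<^sub>k))\<close>, again as a closure, with \<open>g\<close> the weak
  \<open>y\<^sub>k\<close>-gradient of \<open>u\<close>.  Since \<open>unit_cell\<close> has measure one, integrating in addition over
  \<open>y\<^sub>k\<^sub>+\<^sub>1, \<dots>, y\<^sub>n\<close> does not change the norms.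
\<close>

definition cell_space ::
    "nat \<Rightarrow> (real ^ 'd) set \<Rightarrow> nat \<Rightarrow> (real ^ 'd \<Rightarrow> (nat \<Rightarrow> real ^ 'd) \<Rightarrow> real) \<Rightarrow>
     (real ^ 'd \<Rightarrow> (nat \<Rightarrow> real ^ 'd) \<Rightarrow> real ^ 'd) \<Rightarrow> bool" where
  "cell_space n \<Omega> k u g \<longleftrightarrow>
     (\<forall>x \<in> \<Omega>. depends_upto k (u x) \<and> periodic_upto k (u x)) \<and>
     (\<lambda>(x, y). u x y) \<in> L2 (multiscale_measure n \<Omega>) \<and>
     (\<lambda>(x, y). g x y) \<in> L2 (multiscale_measure n \<Omega>) \<and>
     (\<exists>\<psi> D\<psi>. (\<forall>i. cell_test_function \<Omega> k (\<psi> i) (D\<psi> i)) \<and>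
        (\<lambda>i. LINT (x, y)|multiscale_measure n \<Omega>. (u x y - \<psi> i x y)\<^sup>2) \<longlonglongrightarrow> 0 \<and>
        (\<lambda>i. LINT (x, y)|multiscale_measure n \<Omega>. (norm (g x y - D\<psi> i x y))\<^sup>2) \<longlonglongrightarrow> 0)"

text \<open>
  Here \<open>G x y\<close> is \<open>\<nabla>\<^sub>xu\<^sub>0 + \<Sum>\<^sub>j \<nabla>\<^sub>y\<^sub>ju\<^sub>j\<close>.  In the equation for index \<open>k\<close> the test function does not
  depend on \<open>y\<^sub>k\<^sub>+\<^sub>1, \<dots>, y\<^sub>n\<close>, so it is tested, by Fubini, against the integral of \<open>A G\<close> over
  these variables.
\<close>

definition homogenization_model ::
    "nat \<Rightarrow> (real ^ 'd) set \<Rightarrow> (real ^ 'd \<Rightarrow> real) \<Rightarrow> 'd coefficient \<Rightarrow>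
     (real ^ 'd \<Rightarrow> real) \<Rightarrow> (nat \<Rightarrow> real ^ 'd \<Rightarrow> (nat \<Rightarrow> real ^ 'd) \<Rightarrow> real) \<Rightarrow> bool" where
  "homogenization_model n \<Omega> f A u0 u \<longleftrightarrow>
     (\<exists>g0 g. H10 \<Omega> u0 g0 \<and> (\<forall>k \<in> {1..n}. cell_space n \<Omega> k (u k) (g k)) \<and>
        (let G = (\<lambda>x y. g0 x + (\<Sum>j = 1..n. g j x y)) in
          (\<forall>k \<in> {1..n}. \<forall>\<psi> D\<psi>. cell_test_function \<Omega> k \<psi> D\<psi> \<longrightarrow>
             (LINT (x, y)|multiscale_measure n \<Omega>. (A x y *v G x y) \<bullet> D\<psi> x y) = 0) \<and>
          (\<forall>\<phi> D\<phi>. test_function \<Omega> \<phi> D\<phi> \<longrightarrow>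
             (LINT (x, y)|multiscale_measure n \<Omega>. (A x y *v G x y) \<bullet> D\<phi> x) =
             (LINT x|lebesgue_on \<Omega>. f x * \<phi> x))))"


section \<open>Discretizations and costs\<close>

text \<open>
  All quantities below are functions of the scale \<open>\<epsilon>\<^sub>1\<close>.  The relation \<open>f \<sim> g\<close> of the cost estimates
  (equality up to constant factors as \<open>\<epsilon>\<^sub>1 \<rightarrow> 0\<close>) is \<open>\<Theta>\<close>, which ignores signs, together with
  positivity of \<open>f\<close>.
\<close>

definition comparable :: "(real \<Rightarrow> real) \<Rightarrow> (real \<Rightarrow> real) \<Rightarrow> bool" where
  "comparable f g \<longleftrightarrow> f \<in> \<Theta>[at_right 0](g) \<and> eventually (\<lambda>\<epsilon>. 0 < f \<epsilon>) (at_right 0)"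

definition classical_cost :: "real \<Rightarrow> real \<Rightarrow> real \<Rightarrow> real \<Rightarrow> real" where
  "classical_cost s unknowns \<kappa> \<delta> = s * unknowns * sqrt \<kappa> * ln (1 / \<delta>)"

definition polylog :: "real \<Rightarrow> real" where
  "polylog z = ln z powr 2.5 * (ln z / ln (ln z))"

definition quantum_cost :: "real \<Rightarrow> real \<Rightarrow> real \<Rightarrow> real" where
  "quantum_cost \<tau> m \<delta> = \<tau> * m * polylog (\<tau> / \<delta>)"

record discretization =
  mesh_size :: "real \<Rightarrow> real"
  nodes :: "real \<Rightarrow> nat"
  condition_number :: "real \<Rightarrow> real"

record simulation =
  hamiltonian_sparsity :: "real \<Rightarrow> real"
  hamiltonian_max :: "real \<Rightarrow> real"
  evolution_time :: "real \<Rightarrow> real"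
  lambda_min :: "real \<Rightarrow> real"
  p_step :: "real \<Rightarrow> real"
  qubits :: "real \<Rightarrow> nat"

definition tau :: "simulation \<Rightarrow> real \<Rightarrow> real" where
  "tau S \<epsilon> = hamiltonian_sparsity S \<epsilon> * hamiltonian_max S \<epsilon> * evolution_time S \<epsilon>"

definition schroedingerisation :: "(real \<Rightarrow> real) \<Rightarrow> simulation \<Rightarrow> bool" where
  "schroedingerisation \<delta> S \<longleftrightarrow>
     eventually (\<lambda>\<epsilon>. 0 < lambda_min S \<epsilon>) (at_right 0) \<and>
     comparable (evolution_time S) (\<lambda>\<epsilon>. ln (1 / \<delta> \<epsilon>) / lambda_min S \<epsilon>) \<and>
     comparable (p_step S) \<delta>"

text \<open>In the canonical estimates, \<open>\<epsilon>n\<close> is the finest scale as a function of \<open>\<epsilon>\<^sub>1\<close>.\<close>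

definition canonical_discretization ::
    "nat \<Rightarrow> (real \<Rightarrow> real) \<Rightarrow> (real \<Rightarrow> real) \<Rightarrow> discretization \<Rightarrow> bool" where
  "canonical_discretization d \<epsilon>n \<delta> D \<longleftrightarrow>
     comparable (mesh_size D) (\<lambda>\<epsilon>. sqrt (\<delta> \<epsilon> * \<epsilon>n \<epsilon>)) \<and>
     comparable (\<lambda>\<epsilon>. real (nodes D \<epsilon>)) (\<lambda>\<epsilon>. 1 / mesh_size D \<epsilon>) \<and>
     comparable (condition_number D) (\<lambda>\<epsilon>. 3 ^ d * real d / (mesh_size D \<epsilon>)\<^sup>2)"

definition homogenization_discretization ::
    "nat \<Rightarrow> nat \<Rightarrow> (real \<Rightarrow> real) \<Rightarrow> discretization \<Rightarrow> bool" where
  "homogenization_discretization n d \<delta> D \<longleftrightarrow>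
     comparable (mesh_size D) (\<lambda>\<epsilon>. sqrt (\<delta> \<epsilon>)) \<and>
     comparable (\<lambda>\<epsilon>. real (nodes D \<epsilon>)) (\<lambda>\<epsilon>. 1 / mesh_size D \<epsilon>) \<and>
     comparable (condition_number D) (\<lambda>\<epsilon>. 3 ^ ((n + 1) * d) * real d / (mesh_size D \<epsilon>)\<^sup>2)"

definition canonical_simulation ::
    "nat \<Rightarrow> (real \<Rightarrow> real) \<Rightarrow> discretization \<Rightarrow> simulation \<Rightarrow> bool" where
  "canonical_simulation d \<delta> D S \<longleftrightarrow> schroedingerisation \<delta> S \<and>
     comparable (tau S)
       (\<lambda>\<epsilon>. 3 ^ (2 * d) * real d / (mesh_size D \<epsilon>)\<^sup>2 * ln (1 / \<delta> \<epsilon>) / p_step S \<epsilon>) \<and>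
     comparable (\<lambda>\<epsilon>. real (qubits S \<epsilon>))
       (\<lambda>\<epsilon>. real d * ln (real (nodes D \<epsilon>)) + ln (1 / p_step S \<epsilon>))"

definition homogenization_simulation ::
    "nat \<Rightarrow> nat \<Rightarrow> (real \<Rightarrow> real) \<Rightarrow> discretization \<Rightarrow> simulation \<Rightarrow> bool" where
  "homogenization_simulation n d \<delta> D S \<longleftrightarrow> schroedingerisation \<delta> S \<and>
     comparable (tau S)
       (\<lambda>\<epsilon>. 3 ^ (2 * (n + 1) * d) * real d / (mesh_size D \<epsilon>)\<^sup>2 * ln (1 / \<delta> \<epsilon>) / p_step S \<epsilon>) \<and>
     comparable (\<lambda>\<epsilon>. real (qubits S \<epsilon>))
       (\<lambda>\<epsilon>. real (n * d) * ln (real (nodes D \<epsilon>)) + ln (1 / p_step S \<epsilon>))"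

definition C_can :: "nat \<Rightarrow> (real \<Rightarrow> real) \<Rightarrow> discretization \<Rightarrow> real \<Rightarrow> real" where
  "C_can d \<delta> D \<epsilon> =
     classical_cost (3 ^ d) (real (nodes D \<epsilon>) ^ d) (condition_number D \<epsilon>) (\<delta> \<epsilon>)"

definition C_hom :: "nat \<Rightarrow> nat \<Rightarrow> (real \<Rightarrow> real) \<Rightarrow> discretization \<Rightarrow> real \<Rightarrow> real" where
  "C_hom n d \<delta> D \<epsilon> =
     classical_cost (\<Sum>k = 1..n + 1. 3 ^ (k * d)) (\<Sum>k = 1..n + 1. real (nodes D \<epsilon>) ^ (k * d))
       (condition_number D \<epsilon>) (\<delta> \<epsilon>)"

definition Q_cost :: "(real \<Rightarrow> real) \<Rightarrow> simulation \<Rightarrow> real \<Rightarrow> real" where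
  "Q_cost \<delta> S \<epsilon> = quantum_cost (tau S \<epsilon>) (real (qubits S \<epsilon>)) (\<delta> \<epsilon>)"


section \<open>Orders\<close>

definition has_order :: "(real \<Rightarrow> real) \<Rightarrow> real \<Rightarrow> bool" where
  "has_order F q \<longleftrightarrow> (\<exists>c C K. 0 < c \<and> 0 < C \<and> 0 \<le> K \<and>
     eventually (\<lambda>\<epsilon>. c * \<epsilon> powr (-q) * ln (1 / \<epsilon>) powr (-K) \<le> F \<epsilon> \<and>
                     F \<epsilon> \<le> C * \<epsilon> powr (-q) * ln (1 / \<epsilon>) powr K) (at_right 0))"

lemma has_order_mono:
  assumes "has_order F p" "has_order G q" "\<And>\<epsilon>. F \<epsilon> \<le> G \<epsilon>"
  shows "p \<le> q"
proof (rule ccontr)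
  assume "\<not> p \<le> q"
  then have pq: "0 < p - q" by simp
  obtain c K where cK: "0 < c" "0 \<le> K"
    "eventually (\<lambda>\<epsilon>. c * \<epsilon> powr (-p) * ln (1 / \<epsilon>) powr (-K) \<le> F \<epsilon>) (at_right 0)"
    using assms(1) unfolding has_order_def by (auto simp: eventually_conj_iff)
  obtain C K' where CK: "0 < C" "0 \<le> K'"
    "eventually (\<lambda>\<epsilon>. G \<epsilon> \<le> C * \<epsilon> powr (-q) * ln (1 / \<epsilon>) powr K') (at_right 0)"
    using assms(2) unfolding has_order_def by (auto simp: eventually_conj_iff)
  have "((\<lambda>\<epsilon>. \<epsilon> powr (p - q) * ln (1 / \<epsilon>) powr (K + K')) \<longlongrightarrow> 0) (at_right 0)"
    using pq by real_asymp
  moreover have "0 < c / C" using cK CK by simp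
  ultimately have "eventually (\<lambda>\<epsilon>. \<epsilon> powr (p - q) * ln (1 / \<epsilon>) powr (K + K') < c / C) (at_right 0)"
    by (rule order_tendstoD(2))
  moreover have "eventually (\<lambda>\<epsilon>::real. 0 < \<epsilon>) (at_right 0)"
    by real_asymp
  moreover have "eventually (\<lambda>\<epsilon>::real. 0 < ln (1 / \<epsilon>)) (at_right 0)"
    by real_asymp
  ultimately have "eventually (\<lambda>\<epsilon>::real. False) (at_right 0)"
    using cK(3) CK(3)
  proof eventually_elim
    case (elim \<epsilon>)
    have pos: "0 < \<epsilon> powr p" "0 < ln (1 / \<epsilon>) powr K" using elim by auto
    have "c * \<epsilon> powr (-p) * ln (1 / \<epsilon>) powr (-K) \<le> C * \<epsilon> powr (-q) * ln (1 / \<epsilon>) powr K'"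
      using elim assms(3)[of \<epsilon>] by linarith
    then have "(c * \<epsilon> powr (-p) * ln (1 / \<epsilon>) powr (-K)) * (\<epsilon> powr p * ln (1 / \<epsilon>) powr K)
             \<le> (C * \<epsilon> powr (-q) * ln (1 / \<epsilon>) powr K') * (\<epsilon> powr p * ln (1 / \<epsilon>) powr K)"
      using pos by (intro mult_right_mono) auto
    then have "c \<le> C * (\<epsilon> powr (p - q) * ln (1 / \<epsilon>) powr (K + K'))"
      using pos by (simp add: powr_minus powr_add powr_diff field_simps)
    then show False using elim CK(1) by (simp add: field_simps)
  qed
  then show False by simp
qed

lemma has_order_unique: "has_order F p \<Longrightarrow> has_order F q \<Longrightarrow> p = q"
  by (meson has_order_mono order_refl order_antisym)

text \<open>Both orders exist (they are unique by the previous lemma), and the first one is smaller.\<close>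

definition order_less :: "(real \<Rightarrow> real) \<Rightarrow> (real \<Rightarrow> real) \<Rightarrow> bool" where
  "order_less F G \<longleftrightarrow> (\<exists>p q. has_order F p \<and> has_order G q \<and> p < q)"

end

theory Submission
  imports Defs
begin

text \<open>
  Orders behave like valuations: they are additive under products, are scaled by powers, and the
  order of a sum is the larger one.  Moreover \<open>ln F\<close> has order \<open>0\<close> if \<open>F\<close> has positive order.
  Hence \<open>C_can\<close>, \<open>C_hom\<close>, \<open>Q_can\<close>, \<open>Q_hom\<close> have the orders \<open>(n + 1) (d + 1) / 2\<close>, \<open>((n + 1) d + 1) / 2\<close>,
  \<open>n + 2\<close> and \<open>2\<close>, where \<open>d\<close> is the dimension.
\<close>

section \<open>Calculus of orders\<close>

lemma has_orderE:
  assumes "has_order F q"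
  obtains c C K where "0 < c" "0 < C" "0 \<le> K"
    "eventually (\<lambda>\<epsilon>. c * \<epsilon> powr (-q) * ln (1 / \<epsilon>) powr (-K) \<le> F \<epsilon>) (at_right 0)"
    "eventually (\<lambda>\<epsilon>. F \<epsilon> \<le> C * \<epsilon> powr (-q) * ln (1 / \<epsilon>) powr K) (at_right 0)"
  using assms unfolding has_order_def eventually_conj_iff by blast

text \<open>A working neighbourhood of 0 for the estimates below: there powers of
  \<open>ln (1 / \<epsilon>)\<close> grow with the exponent, powers of \<epsilon> decrease with it,
  and \<open>ln (ln (1 / \<epsilon>))\<close> is positive.\<close>

lemma eventually_small:
  "eventually (\<lambda>\<epsilon>::real. 0 < \<epsilon> \<and> \<epsilon> < 1 \<and> 1 < ln (1 / \<epsilon>)) (at_right 0)"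
proof -
  have "eventually (\<lambda>\<epsilon>::real. 0 < \<epsilon>) (at_right 0)" by real_asymp
  moreover have "eventually (\<lambda>\<epsilon>::real. \<epsilon> < 1) (at_right 0)" by real_asymp
  moreover have "eventually (\<lambda>\<epsilon>::real. 1 < ln (1 / \<epsilon>)) (at_right 0)" by real_asymp
  ultimately show ?thesis by eventually_elim simp
qed

text \<open>Relaxed introduction rule: the definition asks for one nonnegative logarithmic exponent
  serving both sides, whereas here the two exponents are independent and of any sign.\<close>

lemma has_orderI:
  assumes "0 < c" "0 < C"
    and lo: "eventually (\<lambda>\<epsilon>. c * \<epsilon> powr (-q) * ln (1 / \<epsilon>) powr (-K) \<le> F \<epsilon>) (at_right 0)"
    and up: "eventually (\<lambda>\<epsilon>. F \<epsilon> \<le> C * \<epsilon> powr (-q) * ln (1 / \<epsilon>) powr K') (at_right 0)"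
  shows "has_order F q"
proof -
  \<comment> \<open>Enlarging the exponent weakens both bounds because
    \<open>ln (1 / \<epsilon>)\<close> exceeds 1. The outer maximum with 0 covers negative K and
    K'.\<close>
  define M where "M = max 0 (max K K')"
  have M: "0 \<le> M" "K \<le> M" "K' \<le> M" by (auto simp: M_def)
  have "eventually (\<lambda>\<epsilon>. c * \<epsilon> powr (-q) * ln (1 / \<epsilon>) powr (-M) \<le> F \<epsilon> \<and>
                        F \<epsilon> \<le> C * \<epsilon> powr (-q) * ln (1 / \<epsilon>) powr M) (at_right 0)"
    using lo up eventually_small
  proof eventually_elim
    case (elim \<epsilon>)
    have "ln (1 / \<epsilon>) powr (-M) \<le> ln (1 / \<epsilon>) powr (-K)" "ln (1 / \<epsilon>) powr K' \<le> ln (1 / \<epsilon>) powr M"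
      using elim M by (auto intro: powr_mono)
    then have "c * \<epsilon> powr (-q) * ln (1 / \<epsilon>) powr (-M) \<le> c * \<epsilon> powr (-q) * ln (1 / \<epsilon>) powr (-K)"
      "C * \<epsilon> powr (-q) * ln (1 / \<epsilon>) powr K' \<le> C * \<epsilon> powr (-q) * ln (1 / \<epsilon>) powr M"
      using assms by (intro mult_left_mono; simp)+
    then show ?case using elim by linarith
  qed
  then show ?thesis using assms M unfolding has_order_def by blast
qed

text \<open>The lower bound already forces positivity; this justifies inverting, taking powers and
  logarithms, and dropping summands later.\<close>

lemma has_order_pos:
  assumes "has_order F q"
  shows "eventually (\<lambda>\<epsilon>. 0 < F \<epsilon>) (at_right 0)"
proof -
  obtain c C K where 1: "0 < c"
    "eventually (\<lambda>\<epsilon>. c * \<epsilon> powr (-q) * ln (1 / \<epsilon>) powr (-K) \<le> F \<epsilon>) (at_right 0)"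
    using assms by (rule has_orderE)
  show ?thesis using 1(2) eventually_small
  proof eventually_elim
    case (elim \<epsilon>)
    have "0 < c * \<epsilon> powr (-q) * ln (1 / \<epsilon>) powr (-K)" using 1 elim by simp
    then show ?case using elim by linarith
  qed
qed

lemma has_order_between:
  assumes F: "has_order F q" and "0 < a" "0 < b"
    and lo: "eventually (\<lambda>\<epsilon>. a * F \<epsilon> \<le> G \<epsilon>) (at_right 0)"
    and up: "eventually (\<lambda>\<epsilon>. G \<epsilon> \<le> b * F \<epsilon>) (at_right 0)"
  shows "has_order G q"
proof -
  obtain c C K where 1: "0 < c" "0 < C"
    "eventually (\<lambda>\<epsilon>. c * \<epsilon> powr (-q) * ln (1 / \<epsilon>) powr (-K) \<le> F \<epsilon>) (at_right 0)"
    "eventually (\<lambda>\<epsilon>. F \<epsilon> \<le> C * \<epsilon> powr (-q) * ln (1 / \<epsilon>) powr K) (at_right 0)"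
    using F by (rule has_orderE)
  show ?thesis
  proof (rule has_orderI)
    show "0 < a * c" "0 < b * C" using 1 assms by auto
    show "eventually (\<lambda>\<epsilon>. a * c * \<epsilon> powr (-q) * ln (1 / \<epsilon>) powr (-K) \<le> G \<epsilon>) (at_right 0)"
      using lo 1(3)
    proof eventually_elim
      case (elim \<epsilon>)
      show ?case
        using mult_left_mono[OF elim(2) less_imp_le[OF \<open>0 < a\<close>]] elim(1) unfolding mult.assoc by linarith
    qed
    show "eventually (\<lambda>\<epsilon>. G \<epsilon> \<le> b * C * \<epsilon> powr (-q) * ln (1 / \<epsilon>) powr K) (at_right 0)"
      using up 1(4)
    proof eventually_elim
      case (elim \<epsilon>)
      show ?case
        using mult_left_mono[OF elim(2) less_imp_le[OF \<open>0 < b\<close>]] elim(1) unfolding mult.assoc by linarith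
    qed
  qed
qed

lemma has_order_cong:
  assumes "has_order F q" "eventually (\<lambda>\<epsilon>. F \<epsilon> = G \<epsilon>) (at_right 0)"
  shows "has_order G q"
  by (rule has_order_between[OF assms(1), of 1 1]) (use assms(2) in \<open>auto elim: eventually_mono\<close>)

text \<open>\<Theta> only relates absolute values. Positivity of F is part of
  \<open>comparable\<close> and that of G follows from its order, so the norms can be removed and
  the constants of the O and \<Omega> bounds serve as b and a.\<close>

lemma has_order_comparable:
  assumes "comparable F G" "has_order G q"
  shows "has_order F q"
proof -
  have pos: "eventually (\<lambda>\<epsilon>. 0 < F \<epsilon>) (at_right 0)" and "F \<in> O[at_right 0](G)" "F \<in> \<Omega>[at_right 0](G)"
    using assms(1) unfolding comparable_def by auto
  then obtain a b where a: "0 < a" "eventually (\<lambda>\<epsilon>. a * norm (G \<epsilon>) \<le> norm (F \<epsilon>)) (at_right 0)"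
    and b: "0 < b" "eventually (\<lambda>\<epsilon>. norm (F \<epsilon>) \<le> b * norm (G \<epsilon>)) (at_right 0)"
    by (elim landau_o.bigE landau_omega.bigE)
  show ?thesis
  proof (rule has_order_between[OF assms(2) a(1) b(1)])
    show "eventually (\<lambda>\<epsilon>. a * G \<epsilon> \<le> F \<epsilon>) (at_right 0)"
      using a(2) pos has_order_pos[OF assms(2)] by eventually_elim auto
    show "eventually (\<lambda>\<epsilon>. F \<epsilon> \<le> b * G \<epsilon>) (at_right 0)"
      using b(2) pos has_order_pos[OF assms(2)] by eventually_elim auto
  qed
qed

section \<open>Basic functions and arithmetic operations\<close>

lemma has_order_const: "0 < a \<Longrightarrow> has_order (\<lambda>_. a) 0"
  by (rule has_orderI[of a a 0 0 _ 0]) (use eventually_small in \<open>auto elim!: eventually_mono\<close>)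

text \<open>Orders count powers of \<open>1 / \<epsilon>\<close>, hence the negative sign.\<close>

lemma has_order_id: "has_order (\<lambda>\<epsilon>. \<epsilon>) (-1)"
  by (rule has_orderI[of 1 1 _ 0 _ 0]) (use eventually_small in \<open>auto elim!: eventually_mono\<close>)

lemma has_order_ln_inverse: "has_order (\<lambda>\<epsilon>. ln (1 / \<epsilon>)) 0"
  \<comment> \<open>The lower factor is \<open>ln (1 / \<epsilon>) powr (-K)\<close>, so K = -1
    makes both bounds equal to the function itself.\<close>
  by (rule has_orderI[of 1 1 _ "-1" _ 1]) (use eventually_small in \<open>auto elim!: eventually_mono\<close>)

lemma has_order_mult:
  assumes "has_order F p" "has_order G q"
  shows "has_order (\<lambda>\<epsilon>. F \<epsilon> * G \<epsilon>) (p + q)"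
proof -
  obtain c C K where 1: "0 < c" "0 < C"
    "eventually (\<lambda>\<epsilon>. c * \<epsilon> powr (-p) * ln (1 / \<epsilon>) powr (-K) \<le> F \<epsilon>) (at_right 0)"
    "eventually (\<lambda>\<epsilon>. F \<epsilon> \<le> C * \<epsilon> powr (-p) * ln (1 / \<epsilon>) powr K) (at_right 0)"
    using assms(1) by (rule has_orderE)
  obtain c' C' K' where 2: "0 < c'" "0 < C'"
    "eventually (\<lambda>\<epsilon>. c' * \<epsilon> powr (-q) * ln (1 / \<epsilon>) powr (-K') \<le> G \<epsilon>) (at_right 0)"
    "eventually (\<lambda>\<epsilon>. G \<epsilon> \<le> C' * \<epsilon> powr (-q) * ln (1 / \<epsilon>) powr K') (at_right 0)"
    using assms(2) by (rule has_orderE)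
  note pos = has_order_pos[OF assms(1)] has_order_pos[OF assms(2)]
  \<comment> \<open>One identity for both sides: it is used with the negated exponents for the lower
    bound and with K, K' for the upper one.\<close>
  have split: "c * c' * \<epsilon> powr (-(p + q)) * l powr (k + k') =
      (c * \<epsilon> powr (-p) * l powr k) * (c' * \<epsilon> powr (-q) * l powr k')" for c c' \<epsilon> l k k' :: real
    by (simp only: minus_add_distrib powr_add mult_ac)
  show ?thesis
  proof (rule has_orderI)
    show "0 < c * c'" "0 < C * C'" using 1 2 by auto
    show "eventually (\<lambda>\<epsilon>. c * c' * \<epsilon> powr (-(p + q)) * ln (1 / \<epsilon>) powr (-(K + K')) \<le> F \<epsilon> * G \<epsilon>) (at_right 0)"
      using 1(3) 2(3) pos
    proof eventually_elim
      case (elim \<epsilon>)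
      from mult_mono[OF elim(1,2)] show ?case
        using elim(3,4) 1 2 unfolding minus_add_distrib[of K K'] split by auto
    qed
    show "eventually (\<lambda>\<epsilon>. F \<epsilon> * G \<epsilon> \<le> C * C' * \<epsilon> powr (-(p + q)) * ln (1 / \<epsilon>) powr (K + K')) (at_right 0)"
      using 1(4) 2(4) pos
    proof eventually_elim
      case (elim \<epsilon>)
      from mult_mono[OF elim(1,2)] show ?case
        using elim(3,4) 1 2 unfolding split by auto
    qed
  qed
qed

text \<open>Inversion exchanges the bounds: the upper constant C yields the lower constant
  \<open>inverse C\<close>, and conversely.\<close>

lemma has_order_inverse:
  assumes "has_order F q"
  shows "has_order (\<lambda>\<epsilon>. inverse (F \<epsilon>)) (-q)"
proof -
  obtain c C K where 1: "0 < c" "0 < C"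
    "eventually (\<lambda>\<epsilon>. c * \<epsilon> powr (-q) * ln (1 / \<epsilon>) powr (-K) \<le> F \<epsilon>) (at_right 0)"
    "eventually (\<lambda>\<epsilon>. F \<epsilon> \<le> C * \<epsilon> powr (-q) * ln (1 / \<epsilon>) powr K) (at_right 0)"
    using assms by (rule has_orderE)
  have inv: "inverse c * \<epsilon> powr (-(-q)) * l powr (-k) = inverse (c * \<epsilon> powr (-q) * l powr k)"
    for c \<epsilon> l k :: real
    by (simp add: powr_minus)
  show ?thesis
  proof (rule has_orderI)
    show "0 < inverse C" "0 < inverse c" using 1 by auto
    show "eventually (\<lambda>\<epsilon>. inverse C * \<epsilon> powr (-(-q)) * ln (1 / \<epsilon>) powr (-K) \<le> inverse (F \<epsilon>)) (at_right 0)"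
      using 1(4) has_order_pos[OF assms]
      by eventually_elim (simp only: inv le_imp_inverse_le)
    \<comment> \<open>The double negation of K is kept so that \<open>inv\<close> matches with k =
      -K.\<close>
    show "eventually (\<lambda>\<epsilon>. inverse (F \<epsilon>) \<le> inverse c * \<epsilon> powr (-(-q)) * ln (1 / \<epsilon>) powr (-(-K))) (at_right 0)"
      using 1(3) eventually_small
    proof eventually_elim
      case (elim \<epsilon>)
      have "0 < c * \<epsilon> powr (-q) * ln (1 / \<epsilon>) powr (-K)" using 1 elim by simp
      then show ?case unfolding inv using elim by (intro le_imp_inverse_le)
    qed
  qed
qed

lemma has_order_divide:
  assumes "has_order F p" "has_order G q"
  shows "has_order (\<lambda>\<epsilon>. F \<epsilon> / G \<epsilon>) (p - q)"
  using has_order_mult[OF assms(1) has_order_inverse[OF assms(2)]] by (simp add: divide_inverse)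

text \<open>For a nonnegative exponent r the map \<open>x powr r\<close> is monotone on nonnegative
  x, so the two bounds keep their sides.\<close>

lemma has_order_powr:
  assumes "has_order F q" "0 \<le> r"
  shows "has_order (\<lambda>\<epsilon>. F \<epsilon> powr r) (r * q)"
proof -
  obtain c C K where 1: "0 < c" "0 < C"
    "eventually (\<lambda>\<epsilon>. c * \<epsilon> powr (-q) * ln (1 / \<epsilon>) powr (-K) \<le> F \<epsilon>) (at_right 0)"
    "eventually (\<lambda>\<epsilon>. F \<epsilon> \<le> C * \<epsilon> powr (-q) * ln (1 / \<epsilon>) powr K) (at_right 0)"
    using assms(1) by (rule has_orderE)
  have dist: "(c * \<epsilon> powr (-q) * l powr k) powr r = c powr r * \<epsilon> powr (-(r * q)) * l powr (r * k)"
    if "0 < c" for c \<epsilon> l k :: real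
    using that by (simp add: powr_mult powr_powr mult.commute)
  show ?thesis
  proof (rule has_orderI)
    show "0 < c powr r" "0 < C powr r" using 1 by auto
    show "eventually (\<lambda>\<epsilon>. c powr r * \<epsilon> powr (-(r * q)) * ln (1 / \<epsilon>) powr (-(r * K)) \<le> F \<epsilon> powr r) (at_right 0)"
      using 1(3) has_order_pos[OF assms(1)]
    proof eventually_elim
      case (elim \<epsilon>)
      have "(c * \<epsilon> powr (-q) * ln (1 / \<epsilon>) powr (-K)) powr r \<le> F \<epsilon> powr r"
        using elim 1 assms by (intro powr_mono2) auto
      then show ?case using dist[OF 1(1), of \<epsilon> "ln (1 / \<epsilon>)" "-K"] by simp
    qed
    show "eventually (\<lambda>\<epsilon>. F \<epsilon> powr r \<le> C powr r * \<epsilon> powr (-(r * q)) * ln (1 / \<epsilon>) powr (r * K)) (at_right 0)"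
      using 1(4) has_order_pos[OF assms(1)]
    proof eventually_elim
      case (elim \<epsilon>)
      have "F \<epsilon> powr r \<le> (C * \<epsilon> powr (-q) * ln (1 / \<epsilon>) powr K) powr r"
        using elim 1 assms by (intro powr_mono2) auto
      then show ?case using dist[OF 1(2)] by simp
    qed
  qed
qed

lemma has_order_power:
  assumes "has_order F q"
  shows "has_order (\<lambda>\<epsilon>. F \<epsilon> ^ k) (real k * q)"
  by (rule has_order_cong[OF has_order_powr[OF assms, of "real k"]])
     (use has_order_pos[OF assms] in \<open>auto elim!: eventually_mono simp: powr_realpow\<close>)

lemma has_order_sqrt:
  assumes "has_order F q"
  shows "has_order (\<lambda>\<epsilon>. sqrt (F \<epsilon>)) (q / 2)"
proof -
  have "has_order (\<lambda>\<epsilon>. F \<epsilon> powr (1 / 2)) (q / 2)"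
    using has_order_powr[OF assms, of "1 / 2"] by simp
  then show ?thesis
    by (rule has_order_cong)
       (use has_order_pos[OF assms] in \<open>auto elim!: eventually_mono simp: powr_half_sqrt\<close>)
qed

text \<open>The lower bound comes from F alone, as G is eventually positive. For the upper bound,
  \<open>\<epsilon> powr (-q)\<close> is at most \<open>\<epsilon> powr (-p)\<close> when \<epsilon>
  is below 1; equal orders are allowed.\<close>

lemma has_order_add:
  assumes "has_order F p" "has_order G q" "q \<le> p"
  shows "has_order (\<lambda>\<epsilon>. F \<epsilon> + G \<epsilon>) p"
proof -
  obtain c C K where 1: "0 < c" "0 < C"
    "eventually (\<lambda>\<epsilon>. c * \<epsilon> powr (-p) * ln (1 / \<epsilon>) powr (-K) \<le> F \<epsilon>) (at_right 0)"
    "eventually (\<lambda>\<epsilon>. F \<epsilon> \<le> C * \<epsilon> powr (-p) * ln (1 / \<epsilon>) powr K) (at_right 0)"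
    using assms(1) by (rule has_orderE)
  obtain C' K' where 2: "0 < C'"
    "eventually (\<lambda>\<epsilon>. G \<epsilon> \<le> C' * \<epsilon> powr (-q) * ln (1 / \<epsilon>) powr K') (at_right 0)"
    using assms(2) by (rule has_orderE)
  define M where "M = max K K'"
  show ?thesis
  proof (rule has_orderI)
    show "0 < c" "0 < C + C'" using 1 2 by auto
    show "eventually (\<lambda>\<epsilon>. c * \<epsilon> powr (-p) * ln (1 / \<epsilon>) powr (-K) \<le> F \<epsilon> + G \<epsilon>) (at_right 0)"
      using 1(3) has_order_pos[OF assms(2)] by eventually_elim linarith
    show "eventually (\<lambda>\<epsilon>. F \<epsilon> + G \<epsilon> \<le> (C + C') * \<epsilon> powr (-p) * ln (1 / \<epsilon>) powr M) (at_right 0)"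
      using 1(4) 2(2) eventually_small
    proof eventually_elim
      case (elim \<epsilon>)
      have L: "ln (1 / \<epsilon>) powr K \<le> ln (1 / \<epsilon>) powr M" "ln (1 / \<epsilon>) powr K' \<le> ln (1 / \<epsilon>) powr M"
        using elim by (auto intro!: powr_mono simp: M_def)
      have e: "\<epsilon> powr (-q) \<le> \<epsilon> powr (-p)" using elim assms(3) by (intro powr_mono') auto
      have "C * \<epsilon> powr (-p) * ln (1 / \<epsilon>) powr K \<le> C * \<epsilon> powr (-p) * ln (1 / \<epsilon>) powr M"
        using L 1 by (intro mult_left_mono) auto
      moreover have "C' * \<epsilon> powr (-q) * ln (1 / \<epsilon>) powr K' \<le> C' * \<epsilon> powr (-p) * ln (1 / \<epsilon>) powr M"
        using L 2 e by (intro mult_mono mult_left_mono) auto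
      ultimately show ?case using elim by (simp add: algebra_simps)
    qed
  qed
qed

section \<open>Logarithms, polylogarithms and sums of powers\<close>

lemma ln_has_order_bounds:
  assumes "has_order F q" "0 < q"
  shows "eventually (\<lambda>\<epsilon>. q / 2 * ln (1 / \<epsilon>) \<le> ln (F \<epsilon>)) (at_right 0)"
    and "eventually (\<lambda>\<epsilon>. ln (F \<epsilon>) \<le> 2 * q * ln (1 / \<epsilon>)) (at_right 0)"
proof -
  obtain c C K where 1: "0 < c" "0 < C"
    "eventually (\<lambda>\<epsilon>. c * \<epsilon> powr (-q) * ln (1 / \<epsilon>) powr (-K) \<le> F \<epsilon>) (at_right 0)"
    "eventually (\<lambda>\<epsilon>. F \<epsilon> \<le> C * \<epsilon> powr (-q) * ln (1 / \<epsilon>) powr K) (at_right 0)"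
    using assms(1) by (rule has_orderE)
  \<comment> \<open>With L = \<open>ln (1 / \<epsilon>)\<close>, the logarithm of a bound is q L
    plus a constant and a multiple of ln L. Since q is positive, the last two are negligible against
    q L, and the factors 1/2 and 2 absorb them.\<close>
  have ln_eq: "ln (c * \<epsilon> powr (-q) * ln (1 / \<epsilon>) powr k) = ln c + q * ln (1 / \<epsilon>) + k * ln (ln (1 / \<epsilon>))"
    if "0 < c" "0 < \<epsilon> \<and> \<epsilon> < 1 \<and> 1 < ln (1 / \<epsilon>)" for c k \<epsilon> :: real
    using that by (simp add: ln_mult ln_powr ln_div)
  have "eventually (\<lambda>\<epsilon>. q / 2 * ln (1 / \<epsilon>) \<le> ln c + q * ln (1 / \<epsilon>) + - K * ln (ln (1 / \<epsilon>))) (at_right 0)"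
    using assms(2) by real_asymp
  with 1(3) eventually_small
  show "eventually (\<lambda>\<epsilon>. q / 2 * ln (1 / \<epsilon>) \<le> ln (F \<epsilon>)) (at_right 0)"
  proof eventually_elim
    case (elim \<epsilon>)
    have "0 < c * \<epsilon> powr (-q) * ln (1 / \<epsilon>) powr (-K)" using 1 elim by simp
    then have "ln (c * \<epsilon> powr (-q) * ln (1 / \<epsilon>) powr (-K)) \<le> ln (F \<epsilon>)"
      using elim(1) by (intro ln_mono) auto
    then show ?case unfolding ln_eq[OF 1(1) elim(2)] using elim(3) by linarith
  qed
  have "eventually (\<lambda>\<epsilon>. ln C + q * ln (1 / \<epsilon>) + K * ln (ln (1 / \<epsilon>)) \<le> 2 * q * ln (1 / \<epsilon>)) (at_right 0)"
    using assms(2) by real_asymp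
  with 1(4) eventually_small has_order_pos[OF assms(1)]
  show "eventually (\<lambda>\<epsilon>. ln (F \<epsilon>) \<le> 2 * q * ln (1 / \<epsilon>)) (at_right 0)"
  proof eventually_elim
    case (elim \<epsilon>)
    have "ln (F \<epsilon>) \<le> ln (C * \<epsilon> powr (-q) * ln (1 / \<epsilon>) powr K)"
      using elim(1,3) by (intro ln_mono) auto
    then show ?case unfolding ln_eq[OF 1(2) elim(2)] using elim(4) by linarith
  qed
qed

lemma has_order_ln:
  assumes "has_order F q" "0 < q"
  shows "has_order (\<lambda>\<epsilon>. ln (F \<epsilon>)) 0"
  using ln_has_order_bounds[OF assms] assms(2)
  by (intro has_order_between[OF has_order_ln_inverse, of "q / 2" "2 * q"]) auto

lemma has_order_polylog:
  assumes "has_order F q" "0 < q"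
  shows "has_order (\<lambda>\<epsilon>. polylog (F \<epsilon>)) 0"
proof -
  \<comment> \<open>The threshold \<open>exp 1\<close> makes the iterated logarithm at least 1,
    which gives the positive lower bound required for dividing by it.\<close>
  have large: "eventually (\<lambda>\<epsilon>. exp 1 \<le> ln (F \<epsilon>)) (at_right 0)"
  proof -
    have "eventually (\<lambda>\<epsilon>. exp 1 \<le> q / 2 * ln (1 / \<epsilon>)) (at_right 0)"
      using assms(2) by real_asymp
    with ln_has_order_bounds(1)[OF assms] show ?thesis by eventually_elim linarith
  qed
  note ln_order = has_order_ln[OF assms]
  \<comment> \<open>\<open>has_order_ln\<close> does not apply again, since
    \<open>ln (F \<epsilon>)\<close> has order 0 rather than a positive one. The iterated logarithm
    is instead bounded below by 1 and above by \<open>ln (F \<epsilon>)\<close>.\<close>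
  have lnln: "has_order (\<lambda>\<epsilon>. ln (ln (F \<epsilon>))) 0"
  proof -
    obtain C K where 1: "0 < C"
      "eventually (\<lambda>\<epsilon>. ln (F \<epsilon>) \<le> C * \<epsilon> powr (-0) * ln (1 / \<epsilon>) powr K) (at_right 0)"
      using ln_order by (rule has_orderE)
    show ?thesis
    proof (rule has_orderI[of 1 C 0 0 _ K])
      show "eventually (\<lambda>\<epsilon>. 1 * \<epsilon> powr (-0) * ln (1 / \<epsilon>) powr (-0) \<le> ln (ln (F \<epsilon>))) (at_right 0)"
        using large eventually_small
      proof eventually_elim
        case (elim \<epsilon>)
        then have "1 \<le> ln (ln (F \<epsilon>))" by (subst ln_ge_iff) (auto intro: less_le_trans[OF exp_gt_zero])
        then show ?case using elim by simp
      qed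
      show "eventually (\<lambda>\<epsilon>. ln (ln (F \<epsilon>)) \<le> C * \<epsilon> powr (-0) * ln (1 / \<epsilon>) powr K) (at_right 0)"
        using large 1(2)
      proof eventually_elim
        case (elim \<epsilon>)
        then have "0 < ln (F \<epsilon>)" by (auto intro: less_le_trans[OF exp_gt_zero])
        then show ?case using ln_less_self[of "ln (F \<epsilon>)"] elim by linarith
      qed
    qed (use 1 in auto)
  qed
  have "has_order (\<lambda>\<epsilon>. ln (F \<epsilon>) powr 2.5 * (ln (F \<epsilon>) / ln (ln (F \<epsilon>)))) (2.5 * 0 + (0 - 0))"
    by (intro has_order_mult has_order_powr has_order_divide ln_order lnln) auto
  then show ?thesis by (simp add: polylog_def)
qed

text \<open>Since q is nonnegative, the orders of the summands do not decrease with k, so the top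
  summand determines the order.\<close>

lemma has_order_power_sum:
  assumes "has_order F q" "0 \<le> q"
  shows "has_order (\<lambda>\<epsilon>. \<Sum>k = 1..n + 1. F \<epsilon> ^ (k * d)) (real ((n + 1) * d) * q)"
proof (induction n)
  case 0
  show ?case using has_order_power[OF assms(1), of d] by simp
next
  case (Suc n)
  \<comment> \<open>The new top power is written first because \<open>has_order_add\<close> takes
    its first summand as the dominant one.\<close>
  have "has_order (\<lambda>\<epsilon>. F \<epsilon> ^ ((Suc n + 1) * d) + (\<Sum>k = 1..n + 1. F \<epsilon> ^ (k * d))) (real ((Suc n + 1) * d) * q)"
    by (rule has_order_add[OF has_order_power[OF assms(1)] Suc.IH])
       (intro mult_right_mono; use assms(2) in simp)
  moreover have "{1..Suc n + 1} = insert (Suc n + 1) {1..n + 1}" by auto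
  ultimately show ?case by simp
qed


section \<open>Orders of the costs\<close>

lemma has_order_nodes:
  assumes "has_order (mesh_size D) (-r)"
    "comparable (\<lambda>\<epsilon>. real (nodes D \<epsilon>)) (\<lambda>\<epsilon>. 1 / mesh_size D \<epsilon>)"
  shows "has_order (\<lambda>\<epsilon>. real (nodes D \<epsilon>)) r"
  using has_order_comparable[OF assms(2) has_order_divide[OF has_order_const[of 1] assms(1)]] by simp

lemma has_order_mesh_power:
  assumes "has_order (mesh_size D) (-r)" "0 < s"
  shows "has_order (\<lambda>\<epsilon>. s / (mesh_size D \<epsilon>)\<^sup>2) (2 * r)"
  using has_order_divide[OF has_order_const[OF assms(2)] has_order_power[OF assms(1), of 2]] by simp

text \<open>Here h behaves like \<open>\<epsilon> powr r\<close>. The sparsity is constant and the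
  logarithm of 1/\<delta> has order 0, so the unknowns contribute q and the square root of \<kappa>,
  itself of order 2 r, contributes r.\<close>

lemma has_order_classical_cost:
  assumes "has_order (mesh_size D) (-r)" "0 < s" "0 < a" "has_order \<delta> (-1)" "has_order U q"
    "comparable (condition_number D) (\<lambda>\<epsilon>. a / (mesh_size D \<epsilon>)\<^sup>2)"
  shows "has_order (\<lambda>\<epsilon>. classical_cost s (U \<epsilon>) (condition_number D \<epsilon>) (\<delta> \<epsilon>)) (q + r)"
proof -
  have "has_order (\<lambda>\<epsilon>. ln (1 / \<delta> \<epsilon>)) 0"
    using has_order_divide[OF has_order_const[of 1] assms(4)] by (intro has_order_ln[of _ 1]) auto
  moreover have "has_order (condition_number D) (2 * r)"
    using assms by (intro has_order_comparable[OF assms(6)] has_order_mesh_power)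
  ultimately have "has_order (\<lambda>\<epsilon>. s * U \<epsilon> * sqrt (condition_number D \<epsilon>) * ln (1 / \<delta> \<epsilon>)) (0 + q + 2 * r / 2 + 0)"
    using assms by (intro has_order_mult has_order_const has_order_sqrt)
  then show ?thesis by (simp add: classical_cost_def)
qed

text \<open>The factor 1/h^2 contributes 2 r and 1/\<Delta>p contributes 1; qubits and polylogarithm
  have order 0. The dimension enters only through the constants a and b, whereas it enters the
  exponent of the classical cost.\<close>

lemma has_order_Q_cost:
  assumes "has_order (mesh_size D) (-r)" "0 < r" "has_order \<delta> (-1)" "0 < a" "0 < b"
    "comparable (\<lambda>\<epsilon>. real (nodes D \<epsilon>)) (\<lambda>\<epsilon>. 1 / mesh_size D \<epsilon>)"
    "comparable (p_step S) \<delta>"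
    "comparable (tau S) (\<lambda>\<epsilon>. a / (mesh_size D \<epsilon>)\<^sup>2 * ln (1 / \<delta> \<epsilon>) / p_step S \<epsilon>)"
    "comparable (\<lambda>\<epsilon>. real (qubits S \<epsilon>)) (\<lambda>\<epsilon>. b * ln (real (nodes D \<epsilon>)) + ln (1 / p_step S \<epsilon>))"
  shows "has_order (Q_cost \<delta> S) (2 * r + 1)"
proof -
  have inv_delta: "has_order (\<lambda>\<epsilon>. ln (1 / \<delta> \<epsilon>)) 0"
    using has_order_divide[OF has_order_const[of 1] assms(3)] by (intro has_order_ln[of _ 1]) auto
  have p: "has_order (p_step S) (-1)"
    using assms by (intro has_order_comparable[OF assms(7)])
  have inv_p: "has_order (\<lambda>\<epsilon>. ln (1 / p_step S \<epsilon>)) 0"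
    using has_order_divide[OF has_order_const[of 1] p] by (intro has_order_ln[of _ 1]) auto
  have tau: "has_order (tau S) (2 * r + 1)"
  proof (rule has_order_comparable[OF assms(8)])
    have "has_order (\<lambda>\<epsilon>. a / (mesh_size D \<epsilon>)\<^sup>2 * ln (1 / \<delta> \<epsilon>) / p_step S \<epsilon>) (2 * r + 0 - (-1))"
      using assms by (intro has_order_divide has_order_mult inv_delta p has_order_mesh_power)
    then show "has_order (\<lambda>\<epsilon>. a / (mesh_size D \<epsilon>)\<^sup>2 * ln (1 / \<delta> \<epsilon>) / p_step S \<epsilon>) (2 * r + 1)" by simp
  qed
  have nodes: "has_order (\<lambda>\<epsilon>. ln (real (nodes D \<epsilon>))) 0"
    using has_order_nodes[OF assms(1,6)] assms(2) by (rule has_order_ln)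
  have qubits: "has_order (\<lambda>\<epsilon>. real (qubits S \<epsilon>)) 0"
    using has_order_mult[OF has_order_const[OF assms(5)] nodes] inv_p
    by (intro has_order_comparable[OF assms(9)] has_order_add[where q = 0]) auto
  \<comment> \<open>The argument of the polylogarithm has order 2 r + 2, which is positive as
    \<open>has_order_polylog\<close> demands.\<close>
  have "has_order (\<lambda>\<epsilon>. tau S \<epsilon> / \<delta> \<epsilon>) (2 * r + 1 - (-1))"
    by (intro has_order_divide tau assms)
  then have "has_order (\<lambda>\<epsilon>. polylog (tau S \<epsilon> / \<delta> \<epsilon>)) 0"
    by (rule has_order_polylog) (use assms(2) in simp)
  then have "has_order (\<lambda>\<epsilon>. tau S \<epsilon> * real (qubits S \<epsilon>) * polylog (tau S \<epsilon> / \<delta> \<epsilon>)) (2 * r + 1 + 0 + 0)"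
    by (intro has_order_mult tau qubits)
  then show ?thesis by (simp add: Q_cost_def[abs_def] quantum_cost_def)
qed

section \<open>Exponents of the two models\<close>

lemma canonical_orders:
  assumes \<delta>: "has_order \<delta> (-1)" and d: "1 \<le> d"
    and D: "canonical_discretization d (\<lambda>\<epsilon>. \<epsilon> ^ n) \<delta> D" and S: "canonical_simulation d \<delta> D S"
  shows "has_order (C_can d \<delta> D) (real ((n + 1) * (d + 1)) / 2)"
    and "has_order (Q_cost \<delta> S) (real n + 2)"
proof -
  \<comment> \<open>h is comparable to the square root of \<delta> times the finest scale
    \<open>\<epsilon> ^ n\<close>, a product of order -(n + 1).\<close>
  define r where "r = real (n + 1) / 2"
  have "has_order (\<lambda>\<epsilon>. sqrt (\<delta> \<epsilon> * \<epsilon> ^ n)) ((- 1 + real n * (-1)) / 2)"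
    by (intro has_order_sqrt has_order_mult has_order_power has_order_id \<delta>)
  moreover have "(- 1 + real n * (-1)) / 2 = - r"
    by (simp add: r_def field_simps)
  ultimately have "has_order (\<lambda>\<epsilon>. sqrt (\<delta> \<epsilon> * \<epsilon> ^ n)) (-r)" by (simp only:)
  then have h: "has_order (mesh_size D) (-r)"
    using D has_order_comparable unfolding canonical_discretization_def by blast
  have N: "comparable (\<lambda>\<epsilon>. real (nodes D \<epsilon>)) (\<lambda>\<epsilon>. 1 / mesh_size D \<epsilon>)"
    using D unfolding canonical_discretization_def by blast
  have "has_order (C_can d \<delta> D) (real d * r + r)"
    unfolding C_can_def
    by (rule has_order_classical_cost[OF h _ _ \<delta> has_order_power[OF has_order_nodes[OF h N]],
          where a = "3 ^ d * real d"])
       (use D d in \<open>auto simp: canonical_discretization_def\<close>)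
  moreover have "real d * r + r = real ((n + 1) * (d + 1)) / 2"
    by (simp add: r_def field_simps)
  ultimately show "has_order (C_can d \<delta> D) (real ((n + 1) * (d + 1)) / 2)" by (simp only:)
  have "has_order (Q_cost \<delta> S) (2 * r + 1)"
    by (rule has_order_Q_cost[OF h _ \<delta> _ _ N, where a = "3 ^ (2 * d) * real d" and b = "real d"])
       (use S d in \<open>auto simp: canonical_simulation_def schroedingerisation_def r_def\<close>)
  moreover have "2 * r + 1 = real n + 2" by (simp add: r_def)
  ultimately show "has_order (Q_cost \<delta> S) (real n + 2)" by (simp only:)
qed

lemma homogenization_orders:
  assumes \<delta>: "has_order \<delta> (-1)" and d: "1 \<le> d" and n: "1 \<le> n"
    and D: "homogenization_discretization n d \<delta> D" and S: "homogenization_simulation n d \<delta> D S"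
  shows "has_order (C_hom n d \<delta> D) (real ((n + 1) * d + 1) / 2)"
    and "has_order (Q_cost \<delta> S) 2"
proof -
  \<comment> \<open>The mesh resolves no fine scale: its exponent is 1/2 for every n.\<close>
  have "has_order (\<lambda>\<epsilon>. sqrt (\<delta> \<epsilon>)) (- (1 / 2))"
    using has_order_sqrt[OF \<delta>] by simp
  then have h: "has_order (mesh_size D) (- (1 / 2))"
    using D has_order_comparable unfolding homogenization_discretization_def by blast
  have N: "comparable (\<lambda>\<epsilon>. real (nodes D \<epsilon>)) (\<lambda>\<epsilon>. 1 / mesh_size D \<epsilon>)"
    using D unfolding homogenization_discretization_def by blast
  \<comment> \<open>The block of N^((n + 1) d) unknowns dominates and contributes (n + 1) d / 2; the
    condition number adds 1/2.\<close>
  have "has_order (C_hom n d \<delta> D) (real ((n + 1) * d) * (1 / 2) + 1 / 2)"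
    unfolding C_hom_def
    by (rule has_order_classical_cost[OF h _ _ \<delta> has_order_power_sum[OF has_order_nodes[OF h N]],
          where a = "3 ^ ((n + 1) * d) * real d"])
       (use D d in \<open>auto simp: homogenization_discretization_def intro!: add_nonneg_pos sum_nonneg\<close>)
  moreover have "real ((n + 1) * d) * (1 / 2) + 1 / 2 = real ((n + 1) * d + 1) / 2"
    by (simp add: field_simps)
  ultimately show "has_order (C_hom n d \<delta> D) (real ((n + 1) * d + 1) / 2)" by (simp only:)
  have "has_order (Q_cost \<delta> S) (2 * (1 / 2) + 1)"
    by (rule has_order_Q_cost[OF h _ \<delta> _ _ N,
          where a = "3 ^ (2 * (n + 1) * d) * real d" and b = "real (n * d)"])
       (use S d n in \<open>auto simp: homogenization_simulation_def schroedingerisation_def\<close>)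
  then show "has_order (Q_cost \<delta> S) 2" by simp
qed

section \<open>Comparison of the four exponents\<close>

theorem theorem1:
  fixes n :: nat
    and \<Omega> :: "(real ^ 'd) set"
    and f :: "real ^ 'd \<Rightarrow> real"
    and A :: "'d coefficient"
    and u_can :: "real \<Rightarrow> real ^ 'd \<Rightarrow> real"
    and u0 :: "real ^ 'd \<Rightarrow> real"
    and u :: "nat \<Rightarrow> real ^ 'd \<Rightarrow> (nat \<Rightarrow> real ^ 'd) \<Rightarrow> real"
    and \<delta> :: "real \<Rightarrow> real" and c :: real
    and D_can D_hom :: discretization
    and S_can S_hom :: simulation
  assumes "1 \<le> n"
    and "multiscale_data n \<Omega> f A"
    and "\<And>\<epsilon>. 0 < \<epsilon> \<Longrightarrow> canonical_model \<Omega> f A (\<lambda>k. \<epsilon> ^ k) (u_can \<epsilon>)"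
    and "homogenization_model n \<Omega> f A u0 u"
    and "0 < c" and "\<And>\<epsilon>. 0 < \<epsilon> \<Longrightarrow> \<delta> \<epsilon> = c * \<epsilon>"
    and "canonical_discretization CARD('d) (\<lambda>\<epsilon>. \<epsilon> ^ n) \<delta> D_can"
    and "canonical_simulation CARD('d) \<delta> D_can S_can"
    and "homogenization_discretization n CARD('d) \<delta> D_hom"
    and "homogenization_simulation n CARD('d) \<delta> D_hom S_hom"
  shows
    "((n + 1) * CARD('d) > 3 \<longrightarrow>
        order_less (Q_cost \<delta> S_hom) (C_hom n CARD('d) \<delta> D_hom)) \<and>
     ((n + 1) * (CARD('d) - 1) > 2 \<longrightarrow>
        order_less (Q_cost \<delta> S_can) (C_can CARD('d) \<delta> D_can)) \<and>
     order_less (C_hom n CARD('d) \<delta> D_hom) (C_can CARD('d) \<delta> D_can) \<and>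
     order_less (Q_cost \<delta> S_hom) (Q_cost \<delta> S_can) \<and>
     ((n + 1) * CARD('d) > 3 \<longrightarrow>
        order_less (Q_cost \<delta> S_hom) (C_can CARD('d) \<delta> D_can) \<and>
        order_less (Q_cost \<delta> S_hom) (Q_cost \<delta> S_can) \<and>
        order_less (Q_cost \<delta> S_hom) (C_hom n CARD('d) \<delta> D_hom))"
proof -
  define d where "d = CARD('d)"
  have d: "1 \<le> d" by (simp add: d_def Suc_le_eq)
  have "has_order (\<lambda>\<epsilon>. c * \<epsilon>) (0 + - 1)"
    using assms(5) by (intro has_order_mult has_order_const has_order_id)
  then have "has_order (\<lambda>\<epsilon>. c * \<epsilon>) (- 1)" by simp
  then have \<delta>: "has_order \<delta> (- 1)"
    by (rule has_order_cong) (use eventually_small assms(6) in \<open>auto elim!: eventually_mono\<close>)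
  note can = canonical_orders[OF \<delta> d assms(7,8)[folded d_def]]
  note hom = homogenization_orders[OF \<delta> d assms(1) assms(9,10)[folded d_def]]
  \<comment> \<open>Quantum against classical for homogenization: 4 < (n + 1) d + 1 is exactly the
    stated threshold.\<close>
  have 1: "2 < real ((n + 1) * d + 1) / 2" if "(n + 1) * d > 3"
  proof -
    have "4 < (n + 1) * d + 1" using that by linarith
    then have "4 < real ((n + 1) * d + 1)" by (metis of_nat_less_iff of_nat_numeral)
    then show ?thesis by simp
  qed
  \<comment> \<open>The canonical threshold comes from (n + 1) (d + 1) = (n + 1) (d - 1) + 2 (n +
    1), which must exceed 2 (n + 2). Writing d as a successor removes the truncated
    subtraction.\<close>
  have 2: "real n + 2 < real ((n + 1) * (d + 1)) / 2" if "(n + 1) * (d - 1) > 2"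
  proof -
    obtain e where e: "d = Suc e" using d by (cases d) auto
    have "2 * (n + 2) < (n + 1) * (d + 1)" using that by (simp add: e algebra_simps)
    then have "real (2 * (n + 2)) < real ((n + 1) * (d + 1))" by (simp only: of_nat_less_iff)
    then show ?thesis by simp
  qed
  \<comment> \<open>The two numerators differ by exactly n, which is positive.\<close>
  have 3: "real ((n + 1) * d + 1) / 2 < real ((n + 1) * (d + 1)) / 2"
    using assms(1) by simp
  have 4: "2 < real n + 2" using assms(1) by simp
  show ?thesis
    unfolding d_def[symmetric] order_less_def
    \<comment> \<open>The remaining comparison, \<open>Q_hom\<close> against \<open>C_can\<close>,
      passes through the exponent of \<open>C_hom\<close> by facts 1 and 3.\<close>
    using can hom 1 2 3 4 less_trans by blast
qed

end
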